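(* Let $N\ge2$. Neither of the functions $(p,q)\mapsto\sum_{i=1}^N(p_i-q_i)\log p_i$ and $(p,q)\mapsto\sum_{i=1}^N p_i\log q_i$, defined on pairs of strictly positive probability mass vectors of size $N$, is a (separable) Bregman divergence. That is: 1. there is no convex differentiable function $\phi:(0,1)\to\mathbb{R}$ such that $$\sum_{i=1}^N(p_i-q_i)\log p_i=\sum_{i=1}^N[\phi(p_i)-\phi(q_i)-(p_i-q_i)\phi'(q_i)]$$ for all strictly positive probability mass vectors $p,q$ of size $N$; and 2. there is no convex differentiable function $\gamma:(0,1)\to\mathbb{R}$ such that $$\sum_{i=1}^N p_i\log q_i=\sum_{i=1}^N[\gamma(p_i)-\gamma(q_i)-(p_i-q_i)\gamma'(q_i)]$$ for all strictly positive probability mass vectors $p,q$ of size $N$.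
   Context: A probability mass vector of size $N$ is $p=(p_1,\dots,p_N)$ with nonnegative entries summing to $1$; strictly positive means all $p_i>0$. A function $d(p,q)$ is a (separable) Bregman divergence with respect to $\Phi(p)=\sum_i\phi(p_i)$, with $\phi$ convex and differentiable, if $d(p,q)=\sum_i[\phi(p_i)-\phi(q_i)-(p_i-q_i)\phi'(q_i)]$. $\log$ is the natural logarithm. *)

theory Defs
  imports "HOL-Analysis.Analysis"
begin

definition prob_mass_vector :: "real ^ 'n \<Rightarrow> bool" where
  "prob_mass_vector p \<longleftrightarrow> (\<forall>i. 0 \<le> p $ i) \<and> (\<Sum>i\<in>UNIV. p $ i) = 1"

definition strictly_positive_pmv :: "real ^ 'n \<Rightarrow> bool" where
  "strictly_positive_pmv p \<longleftrightarrow> prob_mass_vector p \<and> (\<forall>i. 0 < p $ i)"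

definition separable_bregman :: "(real \<Rightarrow> real) \<Rightarrow> real ^ 'n \<Rightarrow> real ^ 'n \<Rightarrow> real" where
  "separable_bregman \<phi> p q =
     (\<Sum>i\<in>UNIV. \<phi> (p $ i) - \<phi> (q $ i) - (p $ i - q $ i) * deriv \<phi> (q $ i))"

text \<open>A generator is a function on the open interval from 0 to 1; it is represented by a total
  function whose values outside this interval are irrelevant. When there are at least two
  coordinates, all entries of a strictly positive probability mass vector lie in the interval;
  since the interval is open, differentiability on it is differentiability at each of its
  points, so \<^const>\<open>deriv\<close> there is the actual derivative.\<close>

definition is_separable_bregman_divergence :: "(real ^ 'n \<Rightarrow> real ^ 'n \<Rightarrow> real) \<Rightarrow> bool" where
  "is_separable_bregman_divergence d \<longleftrightarrow>
     (\<exists>\<phi> :: real \<Rightarrow> real.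
        convex_on {0<..<1} \<phi> \<and> \<phi> differentiable_on {0<..<1} \<and>
        (\<forall>p q. strictly_positive_pmv p \<longrightarrow> strictly_positive_pmv q \<longrightarrow>
           d p q = separable_bregman \<phi> p q))"

end

theory Submission
  imports Defs
begin

text \<open>A Bregman divergence \<open>d p q\<close> is the error of the first-order Taylor approximation
  of \<open>\<Phi>\<close> at \<open>q\<close>. Hence it vanishes at \<open>p = q\<close>, and to first order along every direction
  through \<open>q\<close> as well (lemmas \<open>separable_bregman_self\<close> and
  \<open>separable_bregman_directional_derivative\<close>). Each of the two functions violates one of
  these conditions.

  The function \<open>\<Sum> p i * ln (q i)\<close> takes at \<open>p = q\<close> the value \<open>\<Sum> q i * ln (q i)\<close>, which is
  negative since every entry of \<open>q\<close> is below 1. The function \<open>\<Sum> (p i - q i) * ln (p i)\<close> does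
  vanish at \<open>p = q\<close>, but its derivative there in a direction \<open>v\<close> is \<open>\<Sum> v i * ln (q i)\<close>.
  Moving mass from \<open>b\<close> to \<open>a\<close> keeps the total mass, and gives the derivative
  \<open>ln (q a) - ln (q b)\<close>, which is nonzero as soon as \<open>q a\<close> and \<open>q b\<close> differ.\<close>

lemma separable_bregman_self: "separable_bregman \<phi> q q = 0"
  by (simp add: separable_bregman_def)

text \<open>The linear term of the divergence cancels the derivative of \<open>\<phi>\<close> in each coordinate.\<close>
lemma separable_bregman_directional_derivative:
  fixes q v :: "real ^ 'n"
  assumes "\<phi> differentiable_on {0<..<1}" and "\<And>i. 0 < q $ i" and "\<And>i. q $ i < 1"
  shows "((\<lambda>t. separable_bregman \<phi> (q + t *\<^sub>R v) q) has_real_derivative 0) (at 0)"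
proof -
  have "((\<lambda>t. \<phi> (q $ i + t * v $ i) - \<phi> (q $ i)
            - (q $ i + t * v $ i - q $ i) * deriv \<phi> (q $ i)) has_real_derivative 0) (at 0)" for i
  proof -
    have "\<phi> differentiable at (q $ i)"
      using assms by (simp add: differentiable_on_eq_differentiable_at)
    then have "(\<phi> has_real_derivative deriv \<phi> (q $ i)) (at (q $ i + 0 * v $ i))"
      by (simp add: DERIV_deriv_iff_real_differentiable)
    moreover have "((\<lambda>t. q $ i + t * v $ i) has_real_derivative v $ i) (at 0)"
      by (auto intro!: derivative_eq_intros)
    ultimately have
      "((\<lambda>t. \<phi> (q $ i + t * v $ i)) has_real_derivative deriv \<phi> (q $ i) * v $ i) (at 0)"
      by (rule DERIV_chain2)
    then show ?thesis
      by (auto intro!: derivative_eq_intros)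
  qed
  then have "((\<lambda>t. \<Sum>i\<in>UNIV. \<phi> (q $ i + t * v $ i) - \<phi> (q $ i)
            - (q $ i + t * v $ i - q $ i) * deriv \<phi> (q $ i)) has_real_derivative
            (\<Sum>i\<in>(UNIV :: 'n set). 0)) (at 0)"
    by (intro DERIV_sum)
  then show ?thesis
    by (simp add: separable_bregman_def)
qed

lemma strictly_positive_pmv_less_1:
  fixes q :: "real ^ 'n"
  assumes "CARD('n) \<ge> 2" and "strictly_positive_pmv q"
  shows "q $ i < 1"
proof -
  have "UNIV - {i} \<noteq> {}"
  proof
    assume "UNIV - {i} = {}"
    then have "CARD('n) \<le> card {i}"
      by (intro card_mono) auto
    with assms(1) show False by simp
  qed
  then have "0 < (\<Sum>j\<in>UNIV - {i}. q $ j)"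
    using assms(2) by (intro sum_pos) (auto simp: strictly_positive_pmv_def)
  moreover have "(\<Sum>j\<in>UNIV. q $ j) = q $ i + (\<Sum>j\<in>UNIV - {i}. q $ j)"
    by (simp add: sum.remove)
  ultimately show ?thesis
    using assms(2) by (simp add: strictly_positive_pmv_def prob_mass_vector_def)
qed

text \<open>The strictly positive probability mass vectors form a relatively open subset of the
  hyperplane of total mass 1, so every direction of total mass 0 may be differentiated along.\<close>
lemma eventually_strictly_positive_pmv_line:
  fixes q v :: "real ^ 'n"
  assumes q: "strictly_positive_pmv q" and v: "(\<Sum>i\<in>UNIV. v $ i) = 0"
  shows "\<forall>\<^sub>F t in nhds 0. strictly_positive_pmv (q + t *\<^sub>R v)"
proof -
  have "\<forall>\<^sub>F t in nhds 0. 0 < q $ i + t * v $ i" for i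
  proof (rule order_tendstoD(1))
    show "((\<lambda>t. q $ i + t * v $ i) \<longlongrightarrow> q $ i + 0 * v $ i) (nhds 0)"
      by (intro tendsto_intros filterlim_ident)
    show "0 < q $ i + 0 * v $ i"
      using q by (simp add: strictly_positive_pmv_def)
  qed
  then have "\<forall>\<^sub>F t in nhds 0. \<forall>i. 0 < q $ i + t * v $ i"
    by (simp add: eventually_all_finite)
  then show ?thesis
  proof eventually_elim
    case (elim t)
    have "(\<Sum>i\<in>UNIV. q $ i + t * v $ i) = 1"
      using q v by (simp add: strictly_positive_pmv_def prob_mass_vector_def sum.distrib
          flip: sum_distrib_left)
    with elim show ?case
      by (simp add: strictly_positive_pmv_def prob_mass_vector_def less_imp_le)
  qed
qed

text \<open>The divergence is determined by its generator only at strictly positive probability mass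
  vectors, but these contain a neighbourhood of \<open>q\<close> on the line, which is all that the
  derivative sees.\<close>
lemma bregman_divergence_directional_derivative:
  fixes q v :: "real ^ 'n"
  assumes "CARD('n) \<ge> 2" and "is_separable_bregman_divergence d"
    and q: "strictly_positive_pmv q" and v: "(\<Sum>i\<in>UNIV. v $ i) = 0"
  shows "((\<lambda>t. d (q + t *\<^sub>R v) q) has_real_derivative 0) (at 0)"
proof -
  obtain \<phi> where \<phi>: "\<phi> differentiable_on {0<..<1}"
    and d: "\<And>p q. strictly_positive_pmv p \<Longrightarrow> strictly_positive_pmv q \<Longrightarrow>
              d p q = separable_bregman \<phi> p q"
    using assms(2) unfolding is_separable_bregman_divergence_def by blast
  have "\<forall>\<^sub>F t in nhds 0. d (q + t *\<^sub>R v) q = separable_bregman \<phi> (q + t *\<^sub>R v) q"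
    using eventually_strictly_positive_pmv_line[OF q v] by eventually_elim (rule d[OF _ q])
  moreover have "((\<lambda>t. separable_bregman \<phi> (q + t *\<^sub>R v) q) has_real_derivative 0) (at 0)"
    using q strictly_positive_pmv_less_1[OF assms(1) q]
    by (intro separable_bregman_directional_derivative[OF \<phi>])
       (auto simp: strictly_positive_pmv_def)
  ultimately show ?thesis
    by (simp add: DERIV_cong_ev)
qed

lemma bregman_divergence_self:
  assumes "is_separable_bregman_divergence d" and "strictly_positive_pmv q"
  shows "d q q = 0"
  using assms separable_bregman_self unfolding is_separable_bregman_divergence_def by metis

lemma directional_derivative_log_weighted_difference:
  fixes q v :: "real ^ 'n"
  assumes "\<And>i. 0 < q $ i"
  shows "((\<lambda>t. \<Sum>i\<in>UNIV. ((q + t *\<^sub>R v) $ i - q $ i) * ln ((q + t *\<^sub>R v) $ i))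
           has_real_derivative (\<Sum>i\<in>UNIV. v $ i * ln (q $ i))) (at 0)"
proof (rule DERIV_sum)
  fix i
  show "((\<lambda>t. ((q + t *\<^sub>R v) $ i - q $ i) * ln ((q + t *\<^sub>R v) $ i))
           has_real_derivative v $ i * ln (q $ i)) (at 0)"
    using assms[of i] by (auto intro!: derivative_eq_intros)
qed

text \<open>At the uniform vector \<open>\<Sum> v i * ln (q i)\<close> vanishes in every direction of total mass 0,
  so a contradiction has to be sought at a vector with two different entries.\<close>
lemma ex_nonuniform_strictly_positive_pmv:
  assumes "a \<noteq> b"
  shows "\<exists>q :: real ^ 'n. strictly_positive_pmv q \<and> q $ a \<noteq> q $ b"
proof -
  define N where "N = real CARD('n)"
  have N: "N > 0" by (simp add: N_def)
  define q :: "real ^ 'n" where "q = (\<chi> i. (1 + (if i = a then 1 else 0)) / (N + 1))"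
  have "(\<Sum>i\<in>UNIV. q $ i) = (\<Sum>i\<in>(UNIV :: 'n set). 1 + (if i = a then 1 else 0)) / (N + 1)"
    by (simp add: q_def sum_divide_distrib)
  also have "\<dots> = 1"
    using N by (simp add: sum.distrib N_def)
  finally have "(\<Sum>i\<in>UNIV. q $ i) = 1" .
  moreover have "0 < q $ i" for i
    using N by (simp add: q_def)
  moreover have "q $ a \<noteq> q $ b"
    using N assms by (simp add: q_def)
  ultimately show ?thesis
    by (intro exI[of _ q]) (simp add: strictly_positive_pmv_def prob_mass_vector_def less_imp_le)
qed

theorem mainTheorem11:
  assumes "CARD('n::finite) \<ge> 2"
  shows "\<not> is_separable_bregman_divergence
             (\<lambda>p q :: real ^ 'n. \<Sum>i\<in>UNIV. (p $ i - q $ i) * ln (p $ i)) \<and>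
         \<not> is_separable_bregman_divergence
             (\<lambda>p q :: real ^ 'n. \<Sum>i\<in>UNIV. p $ i * ln (q $ i))"
proof -
  obtain a b :: 'n where ab: "a \<noteq> b"
    using assms by (metis card_2_iff' ex_card)
  obtain q :: "real ^ 'n" where q: "strictly_positive_pmv q" and q_ab: "q $ a \<noteq> q $ b"
    using ex_nonuniform_strictly_positive_pmv[OF ab] by blast
  have pos: "0 < q $ i" for i
    using q by (simp add: strictly_positive_pmv_def)
  show ?thesis
  proof (intro conjI notI)
    assume breg: "is_separable_bregman_divergence
             (\<lambda>p q :: real ^ 'n. \<Sum>i\<in>UNIV. (p $ i - q $ i) * ln (p $ i))"
    define v :: "real ^ 'n" where "v = axis a 1 - axis b 1"
    have v: "(\<Sum>i\<in>UNIV. v $ i) = 0"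
      by (simp add: v_def axis_def sum_subtractf)
    have "(\<Sum>i\<in>UNIV. v $ i * ln (q $ i)) = 0"
      using DERIV_unique[OF directional_derivative_log_weighted_difference[OF pos]
          bregman_divergence_directional_derivative[OF assms breg q v]] .
    moreover have "(\<Sum>i\<in>UNIV. v $ i * ln (q $ i)) = ln (q $ a) - ln (q $ b)"
      by (simp add: v_def axis_def left_diff_distrib sum_subtractf if_distrib[of "\<lambda>x. x * _"]
          cong: if_cong)
    ultimately show False
      using q_ab pos by simp
  next
    assume breg: "is_separable_bregman_divergence
             (\<lambda>p q :: real ^ 'n. \<Sum>i\<in>UNIV. p $ i * ln (q $ i))"
    have "(\<Sum>i\<in>UNIV. q $ i * ln (q $ i)) < (\<Sum>i\<in>(UNIV :: 'n set). 0)"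
    proof (rule sum_strict_mono)
      fix i
      show "q $ i * ln (q $ i) < 0"
        using pos strictly_positive_pmv_less_1[OF assms q] by (simp add: mult_pos_neg)
    qed auto
    then show False
      using bregman_divergence_self[OF breg q] by simp
  qed
qed

end
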